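(* Let $\alpha,\beta,a,b,c,z,p\in\mathbb{C}$ with $\mathrm{Re}(\alpha)>-1$, with $\mathrm{Re}(p)>0$ or $p=0$, with $|\arg(1-z)|<\pi$, and with $\mathrm{Re}(c)>\mathrm{Re}(b)>0$. Then for every $n\in\mathbb{N}$, $$\frac{d^{n}}{dz^{n}}\left\lbrace {}^{\Psi}F_{p}^{(\alpha,\beta)}(a,b;c;z)\right\rbrace =\frac{(a)_{n}(b)_{n}}{(c)_{n}}\;{}^{\Psi}F_{p}^{(\alpha,\beta)}(a+n,b+n;c+n;z).$$
   Context: For $\alpha,\beta\in\mathbb{C}$ with $\mathrm{Re}(\alpha)>-1$, the Wright function is ${}_{0}\Psi_{1}(\alpha,\beta;z)=\sum_{n=0}^{\infty}\frac{1}{\Gamma(\alpha n+\beta)}\frac{z^n}{n!}$ (with $1/\Gamma$ equal to $0$ at the poles of $\Gamma$). The $\Psi$-beta function is, for $\mathrm{Re}(x)>0$, $\mathrm{Re}(y)>0$ and $\mathrm{Re}(p)>0$ (or $p=0$, by the same formula), $${}^{\Psi}B_{p}^{(\alpha,\beta)}(x,y)=\int_{0}^{1}t^{x-1}(1-t)^{y-1}\,{}_{0}\Psi_{1}\left(\alpha,\beta;-\frac{p}{t(1-t)}\right)dt.$$ The $\Psi$-Gauss hypergeometric function is $${}^{\Psi}F_{p}^{(\alpha,\beta)}(a,b;c;z)=\sum_{n=0}^{\infty}(a)_{n}\frac{{}^{\Psi}B_{p}^{(\alpha,\beta)}(b+n,c-b)}{B(b,c-b)}\frac{z^{n}}{n!},$$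 and for $z$ with $|\arg(1-z)|<\pi$ outside the disc of convergence it is understood as the analytic continuation of this series in $z$. Here $B$ is the classical beta function and $(\lambda)_0=1$, $(\lambda)_n=\Gamma(\lambda+n)/\Gamma(\lambda)=\lambda(\lambda+1)\cdots(\lambda+n-1)$. *)

theory Defs
  imports "HOL-Complex_Analysis.Complex_Analysis"
begin

(* rGamma is the entire reciprocal Gamma function, so it vanishes at the poles of Gamma. *)
definition wright_psi :: "complex \<Rightarrow> complex \<Rightarrow> complex \<Rightarrow> complex" where
  "wright_psi \<alpha> \<beta> z = (\<Sum>n. rGamma (\<alpha> * of_nat n + \<beta>) * (z ^ n / fact n))"

(* The gauge integral covers absolutely convergent as well as conditionally convergent
   improper integrals; by library convention its value is 0 when the integral does not exist. *)
definition psi_beta ::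
    "complex \<Rightarrow> complex \<Rightarrow> complex \<Rightarrow> complex \<Rightarrow> complex \<Rightarrow> complex" where
  "psi_beta \<alpha> \<beta> p x y =
     integral {0..1::real} (\<lambda>t. of_real t powr (x - 1) * of_real (1 - t) powr (y - 1) *
       wright_psi \<alpha> \<beta> (- p / of_real (t * (1 - t))))"

definition psi_gauss_series ::
    "complex \<Rightarrow> complex \<Rightarrow> complex \<Rightarrow> complex \<Rightarrow> complex \<Rightarrow> complex \<Rightarrow> complex \<Rightarrow> complex" where
  "psi_gauss_series \<alpha> \<beta> p a b c z =
     (\<Sum>n. pochhammer a n * (psi_beta \<alpha> \<beta> p (b + of_nat n) (c - b) / Beta b (c - b)) *
       (z ^ n / fact n))"

(* The plane cut along [1, infinity).  The point 1 has to be removed explicitly because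
   Arg 0 = 0 in the library, whereas the argument of 0 is undefined. *)
definition slit_plane :: "complex set" where
  "slit_plane = {z. z \<noteq> 1 \<and> \<bar>Arg (1 - z)\<bar> < pi}"

(* Outside the unit disc, the value at z of the analytic continuation of the series to the
   (connected) slit plane.  The description ranges over values rather than functions, since
   a continuation is determined only on the slit plane. *)
definition psi_gauss ::
    "complex \<Rightarrow> complex \<Rightarrow> complex \<Rightarrow> complex \<Rightarrow> complex \<Rightarrow> complex \<Rightarrow> complex \<Rightarrow> complex" where
  "psi_gauss \<alpha> \<beta> p a b c z =
     (if norm z < 1 then psi_gauss_series \<alpha> \<beta> p a b c z
      else (THE w. \<exists>F. F holomorphic_on slit_plane \<and>
              (\<forall>u. norm u < 1 \<longrightarrow> F u = psi_gauss_series \<alpha> \<beta> p a b c u) \<and> F z = w))"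

end

theory Submission imports Defs begin

text \<open>
  The extended beta values \<open>psi_beta \<alpha> \<beta> p (b + n) (c - b)\<close> depend on \<open>b + n\<close> and \<open>c - b\<close> only. Raising
  \<open>a\<close>, \<open>b\<close>, \<open>c\<close> by one therefore shifts this sequence by one place. Since
  \<open>pochhammer a (n + 1) = a * pochhammer (a + 1) n\<close> and \<open>Beta (b + 1) (c - b) = b / c * Beta b (c - b)\<close>,
  the termwise derivative of the series for \<open>(a, b, c)\<close> is \<open>a * b / c\<close> times the series for
  \<open>(a + 1, b + 1, c + 1)\<close>. This holds in the unit disc, the identity theorem carries it to the whole
  slit plane (\<open>deriv_psi_gauss\<close>), and induction on the order gives the theorem.

  The substance is that the analytic continuation exists, so that \<open>psi_gauss\<close> is one
  holomorphic function on the slit plane (\<open>psi_gauss_is_continuation\<close>). The beta values are moments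
  \<open>\<integral> h(t) t^n dt\<close> over \<open>[0, 1]\<close>, and for absolutely integrable \<open>h\<close> Euler's integral
  \<open>\<integral> h(t) (1 - z t) powr (- a) dt\<close> is the continuation. But for \<open>p \<noteq> 0\<close> the argument
  \<open>- p / (t (1 - t))\<close> of the Wright function tends to infinity at both ends of the interval, where the Wright function may
  oscillate or grow. So \<open>h\<close> may be only conditionally integrable, and the integral may even exist
  for some \<open>n\<close> and fail to exist, which gives it the value 0, for smaller ones. Two reductions deal
  with this.

  If the integral exists for \<open>n = N\<close>, then integration by parts writes the moments from \<open>N\<close> on in terms
  of moments of the continuous function \<open>H(t) = \<integral> h(s) s^N ds\<close>, taken over \<open>[0, t]\<close>. Euler's integral
  for \<open>H\<close> is proper and holomorphic in \<open>z\<close>. The remaining finitely many moments are reached by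
  integrating \<open>N\<close> times with respect to \<open>z\<close>: differentiating the series drops one moment and changes
  \<open>a\<close> to \<open>a + 1\<close>, and a holomorphic function on the starlike slit plane has a primitive
  (\<open>continues_to_slit_plane_if_diffs\<close>). If the integral exists for no \<open>n\<close>, the series vanishes.
\<close>

section \<open>The slit plane\<close>

lemma slit_plane_iff: "z \<in> slit_plane \<longleftrightarrow> 1 - z \<notin> \<real>\<^sub>\<le>\<^sub>0"
proof -
  have "\<bar>Arg (1 - z)\<bar> < pi \<longleftrightarrow> Arg (1 - z) \<noteq> pi"
    using mpi_less_Arg[of "1 - z"] Arg_le_pi[of "1 - z"] by linarith
  thus ?thesis
    by (auto simp: slit_plane_def Arg_eq_pi complex_nonpos_Reals_iff complex_eq_iff)
qed

lemma open_slit_plane: "open slit_plane"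
proof -
  have "slit_plane = (\<lambda>z. 1 - z) -` (- \<real>\<^sub>\<le>\<^sub>0)"
    by (auto simp: slit_plane_iff)
  moreover have "open ((\<lambda>z. 1 - z) -` (- \<real>\<^sub>\<le>\<^sub>0 :: complex set))"
    by (intro open_vimage continuous_intros open_Compl closed_nonpos_Reals_complex)
  ultimately show ?thesis by simp
qed

text \<open>
  Besides giving starlikeness, this keeps \<open>1 - z * t\<close> off the branch cut of the power
  function in Euler's integral.
\<close>

lemma scale_in_slit_plane:
  assumes "z \<in> slit_plane" "0 \<le> t" "t \<le> 1"
  shows "z * of_real t \<in> slit_plane"
proof (cases "t = 0")
  case True
  thus ?thesis by (simp add: slit_plane_iff)
next
  case False
  show ?thesis
  proof (rule ccontr)
    assume "z * of_real t \<notin> slit_plane"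
    hence 1: "Re z * t \<ge> 1" and 2: "Im z * t = 0"
      by (auto simp: slit_plane_iff complex_nonpos_Reals_iff)
    have "Im z = 0" using 2 False by simp
    moreover have "Re z \<ge> 1"
    proof (rule ccontr)
      assume "\<not> Re z \<ge> 1"
      hence "Re z * t < 1 * t" using False assms by (intro mult_strict_right_mono) auto
      thus False using 1 assms by simp
    qed
    ultimately show False
      using assms(1) by (auto simp: slit_plane_iff complex_nonpos_Reals_iff)
  qed
qed

lemma starlike_slit_plane: "starlike slit_plane"
  unfolding starlike_def
proof (intro bexI ballI)
  show "0 \<in> slit_plane" by (simp add: slit_plane_iff)
  fix z assume "z \<in> slit_plane"
  thus "closed_segment 0 z \<subseteq> slit_plane"
    using scale_in_slit_plane
    by (auto simp: closed_segment_def scaleR_conv_of_real mult.commute)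
qed

lemma unit_disc_in_slit_plane: "norm z < 1 \<Longrightarrow> z \<in> slit_plane"
  using complex_Re_le_cmod[of z] by (auto simp: slit_plane_iff complex_nonpos_Reals_iff)

lemma slit_plane_identity:
  assumes "f holomorphic_on slit_plane" "g holomorphic_on slit_plane"
    and "\<And>u. norm u < 1 \<Longrightarrow> f u = g u" "z \<in> slit_plane"
  shows "f z = g z"
  by (rule analytic_continuation_open[of "ball 0 1" slit_plane f g z])
     (use assms open_slit_plane starlike_imp_connected[OF starlike_slit_plane]
        unit_disc_in_slit_plane in auto)

section \<open>Power series that continue to the slit plane\<close>

definition continues_to_slit_plane :: "(nat \<Rightarrow> complex) \<Rightarrow> bool" where
  "continues_to_slit_plane c \<longleftrightarrow>
     (\<exists>F. F holomorphic_on slit_plane \<and> (\<forall>u. norm u < 1 \<longrightarrow> (\<lambda>n. c n * u ^ n) sums F u))"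

lemma continues_to_slit_planeE:
  assumes "continues_to_slit_plane c"
  obtains F where "F holomorphic_on slit_plane"
    "\<And>u. norm u < 1 \<Longrightarrow> (\<lambda>n. c n * u ^ n) sums F u"
  using assms unfolding continues_to_slit_plane_def by blast

text \<open>
  A primitive of the continued derivative continues the series itself, up to a constant that
  the disc determines. Convergence of the derived series suffices: its terms dominate those of the
  series divided by the variable.
\<close>

lemma continues_to_slit_plane_if_diffs:
  assumes "continues_to_slit_plane (diffs c)"
  shows "continues_to_slit_plane c"
proof -
  obtain G where G: "G holomorphic_on slit_plane"
      "\<And>u. norm u < 1 \<Longrightarrow> (\<lambda>n. diffs c n * u ^ n) sums G u"
    by (rule continues_to_slit_planeE[OF assms]) blast
  have "\<exists>P. \<forall>z\<in>slit_plane. (P has_field_derivative G z) (at z)"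
    by (rule holomorphic_starlike_primitive[where k = "{}"])
       (use G(1) starlike_slit_plane open_slit_plane holomorphic_on_imp_continuous_on
          holomorphic_on_imp_differentiable_at in auto)
  then obtain P where P: "\<And>z. z \<in> slit_plane \<Longrightarrow> (P has_field_derivative G z) (at z)"
    by blast
  have summ: "summable (\<lambda>n. c n * u ^ n)" if u: "norm u < 1" for u
  proof -
    obtain r where r: "norm u < r" "r < 1" using dense[OF u] by blast
    hence "norm (of_real r :: complex) < 1" using norm_ge_zero[of u] by (simp del: norm_ge_zero)
    hence "summable (\<lambda>n. diffs c n * of_real r ^ n)" using G(2) sums_summable by blast
    hence S: "summable (\<lambda>n. norm (diffs c n * u ^ n))"
      by (rule powser_insidea) (use r in auto)
    have "summable (\<lambda>n. c (Suc n) * u ^ n)"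
    proof (rule summable_comparison_test'[OF S])
      fix n :: nat
      have "norm (c (Suc n) * u ^ n) * 1 \<le> norm (c (Suc n) * u ^ n) * real (Suc n)"
        by (intro mult_left_mono) auto
      also have "\<dots> = norm (diffs c n * u ^ n)"
        by (simp only: diffs_def norm_mult norm_of_nat mult_ac)
      finally show "norm (c (Suc n) * u ^ n) \<le> norm (diffs c n * u ^ n)" by simp
    qed
    hence "summable (\<lambda>n. u * (c (Suc n) * u ^ n))" by (rule summable_mult)
    hence "summable (\<lambda>n. c (Suc n) * u ^ Suc n)" by (simp add: mult_ac)
    thus ?thesis by (subst (asm) summable_Suc_iff)
  qed
  let ?C = "\<lambda>u. \<Sum>n. c n * u ^ n"
  have dC: "(?C has_field_derivative G u) (at u)" if "norm u < 1" for u
    using termdiffs_strong'[of 1 c u, OF summ that] G(2)[OF that] sums_unique by fastforce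
  have "\<exists>k. \<forall>u\<in>ball 0 1. ?C u - P u = k"
  proof (rule has_field_derivative_zero_constant)
    fix u :: complex assume "u \<in> ball 0 1"
    hence u: "norm u < 1" by simp
    have "((\<lambda>u. ?C u - P u) has_field_derivative G u - G u) (at u)"
      by (intro DERIV_diff dC P u unit_disc_in_slit_plane)
    thus "((\<lambda>u. ?C u - P u) has_field_derivative 0) (at u within ball 0 1)"
      by (simp add: has_field_derivative_at_within)
  qed auto
  then obtain k where k: "\<And>u. norm u < 1 \<Longrightarrow> ?C u - P u = k"
    by (metis mem_ball_0)
  have "(\<lambda>u. P u + k) holomorphic_on slit_plane"
    using P by (intro holomorphic_intros) (auto simp: holomorphic_on_open open_slit_plane)
  moreover have "(\<lambda>n. c n * u ^ n) sums (P u + k)" if "norm u < 1" for u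
    using summable_sums[OF summ[OF that]] k[OF that] by (metis add.commute diff_add_cancel)
  ultimately show ?thesis unfolding continues_to_slit_plane_def by blast
qed

definition pochhammer_coeff :: "complex \<Rightarrow> (nat \<Rightarrow> complex) \<Rightarrow> nat \<Rightarrow> complex" where
  "pochhammer_coeff a \<mu> n = pochhammer a n * \<mu> n / fact n"

text \<open>
  Differentiation acts on these series by a shift of the moments and of the parameter \<open>a\<close>. Both
  the reduction to a tail of the moment sequence and the derivative formula rest on this.
\<close>

lemma diffs_pochhammer_coeff:
  "diffs (pochhammer_coeff a \<mu>) = (\<lambda>n. a * pochhammer_coeff (a + 1) (\<lambda>n. \<mu> (Suc n)) n)"
proof
  fix n
  show "diffs (pochhammer_coeff a \<mu>) n = a * pochhammer_coeff (a + 1) (\<lambda>n. \<mu> (Suc n)) n"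
    by (simp add: diffs_def pochhammer_coeff_def pochhammer_rec fact_Suc del: of_nat_Suc)
qed

lemma continues_to_slit_plane_cmult:
  assumes "continues_to_slit_plane c"
  shows "continues_to_slit_plane (\<lambda>n. k * c n)"
proof -
  obtain F where F: "F holomorphic_on slit_plane"
      "\<And>u. norm u < 1 \<Longrightarrow> (\<lambda>n. c n * u ^ n) sums F u"
    by (rule continues_to_slit_planeE[OF assms]) blast
  have "(\<lambda>u. k * F u) holomorphic_on slit_plane" using F by (intro holomorphic_intros)
  moreover have "(\<lambda>n. k * c n * u ^ n) sums (k * F u)" if "norm u < 1" for u
    using sums_mult[OF F(2)[OF that], of k] by (simp add: mult.assoc)
  ultimately show ?thesis unfolding continues_to_slit_plane_def by blast
qed

text \<open>
  The assumption is needed for every \<open>a\<close>, because each of the \<open>N\<close> integrations changes the parameter.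
\<close>

lemma continues_to_slit_plane_if_shift:
  assumes "\<And>a. continues_to_slit_plane (pochhammer_coeff a (\<lambda>k. \<mu> (N + k)))"
  shows "continues_to_slit_plane (pochhammer_coeff a \<mu>)"
  using assms
proof (induction N arbitrary: \<mu> a)
  case 0
  thus ?case by simp
next
  case (Suc N)
  have "continues_to_slit_plane (pochhammer_coeff (a + 1) (\<lambda>k. \<mu> (Suc k)))"
    by (rule Suc.IH) (use Suc.prems in simp)
  hence "continues_to_slit_plane (diffs (pochhammer_coeff a \<mu>))"
    unfolding diffs_pochhammer_coeff by (rule continues_to_slit_plane_cmult)
  thus ?case by (rule continues_to_slit_plane_if_diffs)
qed

section \<open>Continuation for moment sequences\<close>

lemma pochhammer_binomial_series:
  assumes "norm (w :: complex) < 1"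
  shows "(\<lambda>n. pochhammer a n / fact n * w ^ n) sums (1 - w) powr (- a)"
proof -
  have "pochhammer a n / fact n * w ^ n = ((- a) gchoose n) * (- w) ^ n" for n
  proof -
    have "(- 1) ^ n * (- w) ^ n = w ^ n" by (simp flip: power_mult_distrib)
    thus ?thesis by (simp add: gbinomial_pochhammer mult_ac)
  qed
  thus ?thesis
    using gen_binomial_complex[of "- w" "- a"] assms by simp
qed

lemma continuous_on_powr_slit:
  fixes f :: "'a :: topological_space \<Rightarrow> complex"
  assumes "continuous_on A f" "\<And>x. x \<in> A \<Longrightarrow> f x \<notin> \<real>\<^sub>\<le>\<^sub>0"
  shows "continuous_on A (\<lambda>x. f x powr s)"
proof -
  have "continuous_on A (\<lambda>x. exp (s * Ln (f x)))"
    using assms by (intro continuous_intros) auto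
  moreover have "exp (s * Ln (f x)) = f x powr s" if "x \<in> A" for x
    using assms(2)[OF that] by (auto simp: powr_def)
  ultimately show ?thesis by (simp cong: continuous_on_cong)
qed

lemma holomorphic_Euler_integral:
  assumes H: "continuous_on {0..1::real} H"
  shows "(\<lambda>z. integral {0..1} (\<lambda>t. H t * (1 - z * of_real t) powr (- a))) holomorphic_on slit_plane"
proof -
  let ?f = "\<lambda>z t. H t * (1 - z * of_real t) powr (- a)"
  let ?f' = "\<lambda>z t. H t * (a * of_real t * (1 - z * of_real t) powr (- a - 1))"
  \<comment> \<open>Differentiation under the integral sign requires a convex domain, hence the passage to discs.\<close>
  have loc: "(\<lambda>z. integral (cbox 0 1) (?f z)) holomorphic_on ball w r"
    if r: "ball w r \<subseteq> slit_plane" for w r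
  proof (rule leibniz_rule_holomorphic[where fx = ?f'])
    have ns: "1 - z * of_real t \<notin> \<real>\<^sub>\<le>\<^sub>0" if "z \<in> ball w r" "t \<in> {0..1}" for z t
      using scale_in_slit_plane[of z t] that r by (auto simp: slit_plane_iff)
    show "((\<lambda>z. ?f z t) has_field_derivative ?f' z t) (at z within ball w r)"
      if "z \<in> ball w r" "t \<in> cbox 0 1" for z t
      using ns[of z t] that by (auto intro!: derivative_eq_intros)
    show "?f z integrable_on cbox 0 1" if "z \<in> ball w r" for z
      using ns[OF that] H
      by (intro integrable_continuous continuous_on_mult continuous_on_powr_slit continuous_intros) auto
    have "continuous_on (ball w r \<times> cbox 0 1) (\<lambda>x. H (snd x))"
      by (rule continuous_on_compose2[OF H]) (auto intro!: continuous_intros)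
    thus "continuous_on (ball w r \<times> cbox 0 1) (\<lambda>(z, t). ?f' z t)"
      unfolding case_prod_beta using ns
      by (intro continuous_on_mult continuous_on_powr_slit continuous_intros) auto
  qed auto
  show ?thesis
    unfolding holomorphic_on_open[OF open_slit_plane]
  proof
    fix w assume "w \<in> slit_plane"
    then obtain r where r: "r > 0" "ball w r \<subseteq> slit_plane"
      using open_slit_plane openE by blast
    thus "\<exists>f'. DERIV (\<lambda>z. integral {0..1} (?f z)) w :> f'"
      using loc[OF r(2)] by (auto simp: holomorphic_on_open)
  qed
qed

text \<open>
  The binomial series of \<open>(1 - u t) powr (- a)\<close> converges uniformly in \<open>t\<close>, so it may be integrated
  term by term against \<open>H\<close>.
\<close>

lemma Euler_integral_sums:
  assumes H: "continuous_on {0..1::real} H" and u: "norm u < 1"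
  shows "(\<lambda>n. pochhammer_coeff a (\<lambda>k. integral {0..1} (\<lambda>t. H t * of_real t ^ k)) n * u ^ n)
           sums integral {0..1} (\<lambda>t. H t * (1 - u * of_real t) powr (- a))"
proof -
  let ?c = "\<lambda>n. pochhammer a n / fact n"
  let ?g = "\<lambda>n t. H t * (?c n * (u * of_real t) ^ n)"
  obtain M where M: "\<And>t. t \<in> {0..1} \<Longrightarrow> norm (H t) \<le> M"
    using compact_imp_bounded[OF compact_continuous_image[OF H]]
    unfolding bounded_iff by (metis compact_Icc image_eqI)
  obtain r where r: "norm u < r" "r < 1" using dense[OF u] by blast
  have "summable (\<lambda>n. ?c n * (of_real r) ^ n)"
    using pochhammer_binomial_series[of "of_real r" a] r norm_ge_zero[of u]
    by (auto intro!: sums_summable simp del: norm_ge_zero)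
  hence S: "summable (\<lambda>n. M * norm (?c n * u ^ n))"
    by (intro summable_mult powser_insidea) (use r in auto)
  have "uniform_limit {0..1} (\<lambda>N t. \<Sum>n<N. ?g n t) (\<lambda>t. \<Sum>n. ?g n t) sequentially"
  proof (rule Weierstrass_m_test[OF _ S])
    fix n t assume t: "t \<in> {0..1::real}"
    have "norm (?g n t) = norm (H t) * (norm (?c n * u ^ n) * t ^ n)"
      using t by (simp add: norm_mult norm_power power_mult_distrib norm_divide)
    also have "\<dots> \<le> M * (norm (?c n * u ^ n) * 1)"
      using t M[OF t] order_trans[OF norm_ge_zero M[OF t]]
      by (intro mult_mono) (auto simp: power_le_one)
    finally show "norm (?g n t) \<le> M * norm (?c n * u ^ n)" by simp
  qed
  then obtain I J where IJ: "\<And>N. ((\<lambda>t. \<Sum>n<N. ?g n t) has_integral I N) {0..1}"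
      "((\<lambda>t. \<Sum>n. ?g n t) has_integral J) {0..1}" "I \<longlonglongrightarrow> J"
    by (rule uniform_limit_integral) (auto intro!: continuous_intros H)
  have "I N = (\<Sum>n<N. pochhammer_coeff a (\<lambda>k. integral {0..1} (\<lambda>t. H t * of_real t ^ k)) n * u ^ n)" for N
  proof -
    have "((\<lambda>t. \<Sum>n<N. (?c n * u ^ n) * (H t * of_real t ^ n)) has_integral
        (\<Sum>n<N. (?c n * u ^ n) * integral {0..1} (\<lambda>t. H t * of_real t ^ n))) {0..1}"
      by (intro has_integral_sum has_integral_mult_right integrable_integral
            integrable_continuous_real continuous_intros H finite_lessThan)
    moreover have "(\<lambda>t. \<Sum>n<N. (?c n * u ^ n) * (H t * of_real t ^ n)) = (\<lambda>t. \<Sum>n<N. ?g n t)"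
      by (intro ext sum.cong refl) (simp add: power_mult_distrib)
    ultimately show ?thesis
      using has_integral_unique[OF IJ(1)] by (simp add: pochhammer_coeff_def field_simps)
  qed
  moreover have "J = integral {0..1} (\<lambda>t. H t * (1 - u * of_real t) powr (- a))"
  proof -
    have "(\<Sum>n. ?g n t) = H t * (1 - u * of_real t) powr (- a)" if "t \<in> {0..1}" for t
    proof -
      have "norm (u * of_real t) \<le> norm u * 1"
        using that unfolding norm_mult by (intro mult_left_mono) auto
      hence "norm (u * of_real t) < 1" using u by simp
      from sums_mult[OF pochhammer_binomial_series[OF this]] show ?thesis
        by (metis sums_unique)
    qed
    hence "integral {0..1} (\<lambda>t. \<Sum>n. ?g n t) = integral {0..1} (\<lambda>t. H t * (1 - u * of_real t) powr (- a))"
      by (intro integral_cong)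
    thus ?thesis using IJ(2) by (simp add: integral_unique)
  qed
  ultimately show ?thesis using IJ(3) unfolding sums_def by (metis (no_types, lifting) ext)
qed

text \<open>
  The right-hand side for \<open>\<mu> k\<close> is what integration by parts makes of the moments of a function with
  primitive \<open>H\<close>. Summed against the binomial coefficients it becomes
  \<open>H(1) (1 - z) powr (- a) - a z \<integral> H(t) (1 - z t) powr (- (a + 1)) dt\<close>, which is Euler's integral
  after the same integration by parts.
\<close>

lemma continues_to_slit_plane_primitive_moments:
  assumes H: "continuous_on {0..1::real} H"
    and \<mu>: "\<And>k. \<mu> k = H 1 - of_nat k * integral {0..1} (\<lambda>t. H t * of_real t ^ (k - 1))"
  shows "continues_to_slit_plane (pochhammer_coeff a \<mu>)"
proof -
  let ?\<nu> = "\<lambda>k. integral {0..1} (\<lambda>t. H t * of_real t ^ k)"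
  let ?G = "\<lambda>z. integral {0..1} (\<lambda>t. H t * (1 - z * of_real t) powr (- (a + 1)))"
  let ?F = "\<lambda>z. H 1 * (1 - z) powr (- a) - a * z * ?G z"
  have "?F holomorphic_on slit_plane"
    by (intro holomorphic_intros holomorphic_Euler_integral H) (auto simp: slit_plane_iff)
  moreover have "(\<lambda>n. pochhammer_coeff a \<mu> n * u ^ n) sums ?F u" if u: "norm u < 1" for u
  proof -
    have A: "(\<lambda>n. pochhammer a n / fact n * u ^ n * H 1) sums ((1 - u) powr (- a) * H 1)"
      by (intro sums_mult2 pochhammer_binomial_series u)
    have "(\<lambda>n. a * u * (pochhammer_coeff (a + 1) ?\<nu> n * u ^ n)) sums (a * u * ?G u)"
      by (intro sums_mult Euler_integral_sums H u)
    moreover have "a * u * (pochhammer_coeff (a + 1) ?\<nu> n * u ^ n) =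
        pochhammer a (Suc n) / fact (Suc n) * u ^ Suc n * (of_nat (Suc n) * ?\<nu> (Suc n - 1))" for n
      by (simp add: pochhammer_coeff_def pochhammer_rec fact_Suc del: of_nat_Suc)
    ultimately have "(\<lambda>n. pochhammer a (Suc n) / fact (Suc n) * u ^ Suc n *
        (of_nat (Suc n) * ?\<nu> (Suc n - 1))) sums (a * u * ?G u)"
      by simp
    hence B: "(\<lambda>n. pochhammer a n / fact n * u ^ n * (of_nat n * ?\<nu> (n - 1))) sums (a * u * ?G u)"
      by (subst (asm) sums_Suc_iff) simp
    show ?thesis
      using sums_diff[OF A B] by (simp add: \<mu> pochhammer_coeff_def field_simps)
  qed
  ultimately show ?thesis unfolding continues_to_slit_plane_def by blast
qed

text \<open>
  Even if \<open>h\<close> is only conditionally integrable, its indefinite gauge integral is continuous on the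
  closed interval, and it has derivative \<open>h\<close> in the interior outside \<open>S\<close>.
\<close>

lemma moments_by_parts:
  fixes h :: "real \<Rightarrow> complex"
  assumes h: "h integrable_on {0..1}" and S: "finite S"
    and cont: "\<And>t. t \<in> {0<..<1} - S \<Longrightarrow> isCont h t"
  shows "((\<lambda>t. h t * of_real t ^ k) has_integral
           (integral {0..1} h - of_nat k * integral {0..1} (\<lambda>t. integral {0..t} h * of_real t ^ (k - 1)))) {0..1}"
proof -
  let ?H = "\<lambda>t. integral {0..t} h"
  have H: "continuous_on {0..1} ?H" by (rule indefinite_integral_continuous_1[OF h])
  show ?thesis
  proof (rule integration_by_parts_interior_strong[OF bounded_bilinear_mult S, where f = ?H
        and g' = "\<lambda>t. of_nat k * of_real t ^ (k - 1)"])
    fix t :: real assume t: "t \<in> {0<..<1} - S"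
    have "(?H has_vector_derivative h t) (at t within {0..1} - {})"
      using t cont[OF t] h by (intro integral_has_vector_derivative_continuous_at)
        (auto intro: continuous_at_imp_continuous_within)
    thus "(?H has_vector_derivative h t) (at t)"
      using t by (simp add: at_within_Icc_at)
    show "((\<lambda>t. of_real t ^ k :: complex) has_vector_derivative of_nat k * of_real t ^ (k - 1)) (at t)"
      by (rule has_vector_derivative_real_field) (auto intro!: derivative_eq_intros)
  next
    have "((\<lambda>t. of_nat k * (?H t * of_real t ^ (k - 1))) has_integral
        of_nat k * integral {0..1} (\<lambda>t. ?H t * of_real t ^ (k - 1))) {0..1}"
      by (intro has_integral_mult_right integrable_integral integrable_continuous_real
            continuous_intros H)
    thus "((\<lambda>t. ?H t * (of_nat k * of_real t ^ (k - 1))) has_integral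
        ?H 1 * of_real 1 ^ k - ?H 0 * of_real 0 ^ k -
        (integral {0..1} h - of_nat k * integral {0..1} (\<lambda>t. ?H t * of_real t ^ (k - 1)))) {0..1}"
      by (simp add: mult_ac)
  qed (auto intro!: continuous_intros H)
qed

section \<open>The extended beta function\<close>

text \<open>
  Outside the closed disc of convergence the series has no sum, and \<open>suminf\<close> takes one and the same
  default value everywhere; in particular it is locally constant there.
\<close>

lemma isCont_powser_off_circle:
  fixes c :: "nat \<Rightarrow> complex"
  assumes "ereal (norm z) \<noteq> conv_radius c"
  shows "isCont (\<lambda>z. \<Sum>n. c n * z ^ n) z"
proof (cases "ereal (norm z) < conv_radius c")
  case True
  then obtain r where r: "ereal (norm z) < ereal r" "ereal r < conv_radius c"
    using ereal_dense2 by blast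
  hence "summable (\<lambda>n. c n * of_real r ^ n)"
    using norm_ge_zero[of z] by (intro summable_in_conv_radius) (simp del: norm_ge_zero)
  thus ?thesis by (rule isCont_powser) (use r in auto)
next
  case False
  hence "conv_radius c < ereal (norm z)" using assms by simp
  then obtain r where r: "conv_radius c < ereal r" "r < norm z"
    using ereal_dense2[of "conv_radius c" "norm z"] by auto
  have const: "(\<Sum>n. c n * w ^ n) = (THE s. False)" if "r < norm w" for w
  proof -
    have "\<not> summable (\<lambda>n. c n * w ^ n)"
      using r(1) that by (intro not_summable_outside_conv_radius) (simp add: less_trans)
    thus ?thesis by (simp add: suminf_def summable_def)
  qed
  have "open {w :: complex. r < norm w}"
    by (intro open_Collect_less continuous_intros)
  hence "\<forall>\<^sub>F w in nhds z. r < norm w"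
    using r(2) eventually_nhds_in_open[of "{w. r < norm w}" z] by simp
  hence "\<forall>\<^sub>F w in nhds z. (\<Sum>n. c n * w ^ n) = (THE s. False)"
    by (rule eventually_mono) (rule const)
  from isCont_cong[OF this] show ?thesis by simp
qed

text \<open>
  For \<open>p \<noteq> 0\<close> the point \<open>- p / (t (1 - t))\<close> meets a circle about the origin for at most two values of \<open>t\<close>, so
  continuity of the Wright series off its circle of convergence is enough for integration by parts.
\<close>

lemma wright_psi_continuous_except_finite:
  obtains S where "finite S"
    "\<And>t. t \<in> {0<..<1} - S \<Longrightarrow> isCont (\<lambda>t. wright_psi \<alpha> \<beta> (- p / of_real (t * (1 - t)))) t"
proof (cases "p = 0")
  case True
  thus thesis by (intro that[of "{}"]) auto
next
  case False
  define c where "c n = rGamma (\<alpha> * of_nat n + \<beta>) / fact n" for n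
  \<comment> \<open>An infinite radius becomes \<open>r = 0\<close>; then \<open>S\<close> is empty because \<open>p \<noteq> 0\<close>.\<close>
  define r where "r = real_of_ereal (conv_radius c)"
  define S where "S = {t::real. poly [:norm p, - r, r:] t = 0}"
  have W: "wright_psi \<alpha> \<beta> = (\<lambda>z. \<Sum>n. c n * z ^ n)"
    by (simp add: wright_psi_def c_def fun_eq_iff)
  show thesis
  proof (rule that)
    show "finite S" unfolding S_def using False by (intro poly_roots_finite) simp
    fix t assume t: "t \<in> {0<..<1} - S"
    hence pos: "t * (1 - t) > 0" by simp
    have "ereal (norm (- p / of_real (t * (1 - t)))) \<noteq> conv_radius c"
    proof
      assume "ereal (norm (- p / of_real (t * (1 - t)))) = conv_radius c"
      hence "r = norm (- p / of_real (t * (1 - t)))" by (simp add: r_def flip: \<open>_ = conv_radius c\<close>)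
      hence "r = norm p / (t * (1 - t))"
        using pos unfolding norm_divide norm_of_real norm_minus_cancel by simp
      hence "r * (t * (1 - t)) = norm p"
        using pos nonzero_eq_divide_eq[of "t * (1 - t)" r "norm p"] by linarith
      moreover have "poly [:norm p, - r, r:] t = norm p - r * (t * (1 - t))"
        by (simp add: algebra_simps)
      ultimately show False using t unfolding S_def by simp
    qed
    hence "isCont (wright_psi \<alpha> \<beta>) (- p / of_real (t * (1 - t)))"
      unfolding W by (rule isCont_powser_off_circle)
    moreover have "isCont (\<lambda>t. - p / of_real (t * (1 - t))) t"
      using t by (intro continuous_intros) auto
    ultimately show "isCont (\<lambda>t. wright_psi \<alpha> \<beta> (- p / of_real (t * (1 - t)))) t"
      by (rule isCont_o2[rotated])
  qed
qed

lemma continues_to_slit_plane_psi_beta: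
  "continues_to_slit_plane (pochhammer_coeff a (\<lambda>n. psi_beta \<alpha> \<beta> p (b + of_nat n) y))"
proof -
  define h where "h n = (\<lambda>t::real. of_real t powr (b + of_nat n - 1) * of_real (1 - t) powr (y - 1) *
       wright_psi \<alpha> \<beta> (- p / of_real (t * (1 - t))))" for n :: nat
  have psi: "psi_beta \<alpha> \<beta> p (b + of_nat n) y = integral {0..1} (h n)" for n
    by (simp only: psi_beta_def h_def)
  show ?thesis
  proof (cases "\<exists>N. h N integrable_on {0..1}")
    case False
    hence "psi_beta \<alpha> \<beta> p (b + of_nat n) y = 0" for n
      unfolding psi by (simp add: not_integrable_integral)
    thus ?thesis
      unfolding continues_to_slit_plane_def pochhammer_coeff_def
      by (intro exI[of _ "\<lambda>_. 0"]) (auto intro: holomorphic_intros)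
  next
    case True
    then obtain N where N: "h N integrable_on {0..1}" by blast
    obtain S where S: "finite S" "\<And>t. t \<in> {0<..<1} - S \<Longrightarrow>
        isCont (\<lambda>t. wright_psi \<alpha> \<beta> (- p / of_real (t * (1 - t)))) t"
      by (rule wright_psi_continuous_except_finite[of \<alpha> \<beta> p]) blast
    have cont: "isCont (h N) t" if "t \<in> {0<..<1} - S" for t
    proof -
      have nonneg: "complex_of_real t \<notin> \<real>\<^sub>\<le>\<^sub>0" "complex_of_real (1 - t) \<notin> \<real>\<^sub>\<le>\<^sub>0"
        using that by (auto simp: complex_nonpos_Reals_iff)
      show ?thesis
        unfolding h_def
        by (intro isCont_mult S(2) that continuous_intros) (use nonneg in auto)
    qed
    \<comment> \<open>At \<open>t = 0\<close> both sides vanish, since \<open>0 powr s = 0\<close> for every \<open>s\<close>.\<close>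
    have mult: "h (N + k) t = h N t * of_real t ^ k" for k t
    proof (cases "t = 0")
      case False
      thus ?thesis
        using powr_add[of "of_real t" "b + of_nat N - 1" "of_nat k :: complex"]
        by (simp add: h_def algebra_simps powr_nat')
    qed (simp add: h_def)
    show ?thesis
    proof (rule continues_to_slit_plane_if_shift[where N = N])
      fix a
      show "continues_to_slit_plane
          (pochhammer_coeff a (\<lambda>k. psi_beta \<alpha> \<beta> p (b + of_nat (N + k)) y))"
      proof (rule continues_to_slit_plane_primitive_moments)
        show "continuous_on {0..1} (\<lambda>t. integral {0..t} (h N))"
          by (rule indefinite_integral_continuous_1[OF N])
        show "psi_beta \<alpha> \<beta> p (b + of_nat (N + k)) y = integral {0..1} (h N) -
            of_nat k * integral {0..1} (\<lambda>t. integral {0..t} (h N) * of_real t ^ (k - 1))" for k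
          using moments_by_parts[OF N S(1) cont, of k]
          unfolding psi mult[abs_def] by (rule integral_unique)
      qed
    qed
  qed
qed

section \<open>The hypergeometric function and its derivatives\<close>

text \<open>
  The definite description in \<open>psi_gauss\<close> denotes the intended value: a continuation exists by the
  results on \<open>psi_beta\<close>, and any two agree by the identity theorem.
\<close>

lemma psi_gauss_is_continuation:
  obtains F where "F holomorphic_on slit_plane"
    "\<And>z. z \<in> slit_plane \<Longrightarrow> psi_gauss \<alpha> \<beta> p a b c z = F z"
    "\<And>u. norm u < 1 \<Longrightarrow>
       (\<lambda>n. pochhammer_coeff a (\<lambda>n. psi_beta \<alpha> \<beta> p (b + of_nat n) (c - b) / Beta b (c - b)) n * u ^ n)
         sums F u"
proof -
  let ?\<mu> = "\<lambda>n. psi_beta \<alpha> \<beta> p (b + of_nat n) (c - b)"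
  have "continues_to_slit_plane (\<lambda>n. inverse (Beta b (c - b)) * pochhammer_coeff a ?\<mu> n)"
    by (intro continues_to_slit_plane_cmult continues_to_slit_plane_psi_beta)
  moreover have "(\<lambda>n. inverse (Beta b (c - b)) * pochhammer_coeff a ?\<mu> n) =
      pochhammer_coeff a (\<lambda>n. ?\<mu> n / Beta b (c - b))"
    by (simp add: pochhammer_coeff_def fun_eq_iff divide_simps)
  ultimately have "continues_to_slit_plane (pochhammer_coeff a (\<lambda>n. ?\<mu> n / Beta b (c - b)))"
    by (rule subst[rotated])
  then obtain F where F: "F holomorphic_on slit_plane"
    "\<And>u. norm u < 1 \<Longrightarrow> (\<lambda>n. pochhammer_coeff a (\<lambda>n. ?\<mu> n / Beta b (c - b)) n * u ^ n) sums F u"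
    by (rule continues_to_slit_planeE) blast
  have ser: "F u = psi_gauss_series \<alpha> \<beta> p a b c u" if "norm u < 1" for u
    using sums_unique[OF F(2)[OF that]]
    by (simp only: psi_gauss_series_def pochhammer_coeff_def times_divide_eq_left times_divide_eq_right)
  have "psi_gauss \<alpha> \<beta> p a b c z = F z" if z: "z \<in> slit_plane" for z
  proof (cases "norm z < 1")
    case True
    thus ?thesis by (simp add: psi_gauss_def ser)
  next
    case False
    have "(THE w. \<exists>F. F holomorphic_on slit_plane \<and>
              (\<forall>u. norm u < 1 \<longrightarrow> F u = psi_gauss_series \<alpha> \<beta> p a b c u) \<and> F z = w) = F z"
    proof (rule the_equality)
      show "\<exists>G. G holomorphic_on slit_plane \<and>
              (\<forall>u. norm u < 1 \<longrightarrow> G u = psi_gauss_series \<alpha> \<beta> p a b c u) \<and> G z = F z"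
        using F(1) ser by blast
    next
      fix w assume "\<exists>G. G holomorphic_on slit_plane \<and>
              (\<forall>u. norm u < 1 \<longrightarrow> G u = psi_gauss_series \<alpha> \<beta> p a b c u) \<and> G z = w"
      then obtain G where G: "G holomorphic_on slit_plane"
          "\<And>u. norm u < 1 \<Longrightarrow> G u = psi_gauss_series \<alpha> \<beta> p a b c u" "G z = w"
        by blast
      show "w = F z"
        using slit_plane_identity[OF G(1) F(1) _ z] G(2,3) ser by simp
    qed
    thus ?thesis using False by (simp add: psi_gauss_def)
  qed
  with F that show thesis by blast
qed

lemma psi_gauss_holomorphic: "psi_gauss \<alpha> \<beta> p a b c holomorphic_on slit_plane"
  by (rule psi_gauss_is_continuation[of \<alpha> \<beta> p a b c]) (metis holomorphic_transform)

lemma deriv_psi_gauss: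
  assumes bc: "Re c > Re b" "Re b > 0" and z: "z \<in> slit_plane"
  shows "deriv (psi_gauss \<alpha> \<beta> p a b c) z =
    a * b / c * psi_gauss \<alpha> \<beta> p (a + 1) (b + 1) (c + 1) z"
proof -
  let ?\<mu> = "\<lambda>n. psi_beta \<alpha> \<beta> p (b + of_nat n) (c - b)"
  let ?\<nu> = "\<lambda>n. psi_beta \<alpha> \<beta> p (b + 1 + of_nat n) (c + 1 - (b + 1)) / Beta (b + 1) (c + 1 - (b + 1))"
  have nz: "b \<noteq> 0" "c \<noteq> 0" using bc by auto
  have "b \<notin> \<int>\<^sub>\<le>\<^sub>0" using bc(2) by (auto elim!: nonpos_Ints_cases)
  from Beta_plus1_left[OF this, of "c - b"] have "c * Beta (b + 1) (c - b) = b * Beta b (c - b)"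
    by simp
  hence Beta: "Beta (b + 1) (c - b) = b / c * Beta b (c - b)"
    using nz by (simp add: field_simps)
  have \<nu>: "?\<mu> (Suc n) / Beta b (c - b) = b / c * ?\<nu> n" for n
  proof -
    have "c + 1 - (b + 1) = c - b" "b + of_nat (Suc n) = b + 1 + of_nat n" by simp_all
    thus ?thesis using nz by (simp only: Beta) simp
  qed
  obtain F where F: "F holomorphic_on slit_plane"
      "\<And>z. z \<in> slit_plane \<Longrightarrow> psi_gauss \<alpha> \<beta> p a b c z = F z"
      "\<And>u. norm u < 1 \<Longrightarrow>
         (\<lambda>n. pochhammer_coeff a (\<lambda>n. ?\<mu> n / Beta b (c - b)) n * u ^ n) sums F u"
    by (rule psi_gauss_is_continuation[of \<alpha> \<beta> p a b c]) blast
  obtain G where G: "G holomorphic_on slit_plane"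
      "\<And>z. z \<in> slit_plane \<Longrightarrow> psi_gauss \<alpha> \<beta> p (a + 1) (b + 1) (c + 1) z = G z"
      "\<And>u. norm u < 1 \<Longrightarrow> (\<lambda>n. pochhammer_coeff (a + 1) ?\<nu> n * u ^ n) sums G u"
    by (rule psi_gauss_is_continuation[of \<alpha> \<beta> p "a + 1" "b + 1" "c + 1"]) blast
  have disc: "deriv F u = a * b / c * G u" if u: "norm u < 1" for u
  proof -
    let ?d = "pochhammer_coeff a (\<lambda>n. ?\<mu> n / Beta b (c - b))"
    have "((\<lambda>u. \<Sum>n. ?d n * u ^ n) has_field_derivative (\<Sum>n. diffs ?d n * u ^ n)) (at u)"
      by (rule termdiffs_strong'[of 1]) (use F(3) u sums_summable in blast)+
    moreover have "(\<Sum>n. diffs ?d n * u ^ n) = a * b / c * G u"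
    proof -
      have "diffs ?d n * u ^ n = a * b / c * (pochhammer_coeff (a + 1) ?\<nu> n * u ^ n)" for n
        unfolding diffs_pochhammer_coeff \<nu> by (simp add: pochhammer_coeff_def mult_ac)
      thus ?thesis
        using sums_unique[OF sums_mult[OF G(3)[OF u], of "a * b / c"]] by simp
    qed
    ultimately have "((\<lambda>u. \<Sum>n. ?d n * u ^ n) has_field_derivative a * b / c * G u) (at u)" by simp
    hence "(F has_field_derivative a * b / c * G u) (at u)"
      by (rule has_field_derivative_transform_within_open[where S = "ball 0 1"])
         (use u F(3) sums_unique in \<open>auto simp: sums_iff\<close>)
    thus ?thesis by (rule DERIV_imp_deriv)
  qed
  have "deriv (psi_gauss \<alpha> \<beta> p a b c) z = deriv F z"
    by (rule complex_derivative_transform_within_open[OF psi_gauss_holomorphic F(1) open_slit_plane z F(2)])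
  also have "\<dots> = a * b / c * G z"
    by (rule slit_plane_identity[OF _ _ disc z])
       (intro holomorphic_deriv holomorphic_intros F(1) G(1) open_slit_plane)+
  finally show ?thesis using G(2)[OF z] by simp
qed

theorem theorem3p3:
  fixes \<alpha> \<beta> a b c z p :: complex and n :: nat
  assumes "Re \<alpha> > -1"
    and "Re p > 0 \<or> p = 0"
    and "z \<in> slit_plane"
    and "Re c > Re b" and "Re b > 0"
  shows "(deriv ^^ n) (\<lambda>w. psi_gauss \<alpha> \<beta> p a b c w) z =
    pochhammer a n * pochhammer b n / pochhammer c n *
    psi_gauss \<alpha> \<beta> p (a + of_nat n) (b + of_nat n) (c + of_nat n) z"
  using assms(4,5)
proof (induction n arbitrary: a b c)
  case 0
  show ?case by simp
next
  case (Suc n)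
  let ?g = "psi_gauss \<alpha> \<beta> p (a + 1) (b + 1) (c + 1)"
  have "(deriv ^^ Suc n) (psi_gauss \<alpha> \<beta> p a b c) z = (deriv ^^ n) (deriv (psi_gauss \<alpha> \<beta> p a b c)) z"
    by (simp add: funpow_swap1)
  also have "\<dots> = (deriv ^^ n) (\<lambda>w. a * b / c * ?g w) z"
    by (rule higher_deriv_transform_within_open[OF _ _ open_slit_plane assms(3)])
       (intro holomorphic_deriv holomorphic_intros psi_gauss_holomorphic open_slit_plane
          deriv_psi_gauss Suc.prems | assumption)+
  also have "\<dots> = a * b / c * (deriv ^^ n) ?g z"
    by (rule higher_deriv_cmult[OF psi_gauss_holomorphic assms(3) open_slit_plane])
  also have "(deriv ^^ n) ?g z = pochhammer (a + 1) n * pochhammer (b + 1) n / pochhammer (c + 1) n *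
      psi_gauss \<alpha> \<beta> p (a + 1 + of_nat n) (b + 1 + of_nat n) (c + 1 + of_nat n) z"
    using Suc.prems by (intro Suc.IH) auto
  finally show ?case by (simp add: pochhammer_rec add_ac)
qed

end
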